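(* For every number of sellers $N\ge 2$, every reserve price $r\in(0,1]$ and every value distribution $F$ as in the context, the speculator can obtain a strictly positive expected profit in the second-price-auction (SPA) speculation game: there is an offer $p\in[0,r]$ whose induced equilibrium gives the speculator a positive expected profit. Equivalently, there exists a cutoff $v^*\in(0,r]$ with $\Pi^*(v^* )>0$.
   Context: Setting. $N\ge2$ sellers, $\mathcal I=\{1,\dots,N\}$, each own one item; seller $i$'s private value $v_i$ is drawn independently from a CDF $F$ on $[0,1]$ with a density $f$, and $F(0)=0<F(v)$ for all $v\in(0,1]$. An auctioneer buys one item by a reverse second-price auction with reserve $r\in(0,1]$: the lowest bid not exceeding $r$ wins, and the winner is paid the minimum of $r$ and the lowest competing bid. A seller who sells at price $t$ gets $t-v_i$; without a transaction he gets $0$. A speculator owns no item initially and values any item at $0$. Stage 1: the speculator offers every seller the price $p\in[0,r]$ for his item; sellers simultaneously accept or reject. Stage 2: the number of sellers still in the auction and whether the speculator participates are announced; sellers who rejected, and the speculator if he acquired at least one item, take part in the auction. The speculator's profit is his auction revenue minus $p$ times the number of items acquired. Bidding assumption (dominant strategies): in the SPA sellers bid their values, and the speculator bids $0$ for one of his items and withholds the rest. In the perfect Bayesian equilibrium each seller accepts iff $v_i<v^*$ for a cutoff $v^*\in[0,r]$; a cutoff $v^*\in(0,r]$ is induced by the offer $$p^*(v^* )=v^*+\int_{v^*}^r[1-F(x)]^{N-1}dx ,$$ and the speculator's expected profit is $$\Pi^*(v^* )=\sum_{m=0}^{N-1}\binom Nm[F(v^* )]^{N-m}[1-F(v^* )]^m\,y(m,v^*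 )-N F(v^* )p^*(v^* ),\qquad y(m,v^* )=v^*+\int_{v^*}^r\Big[\tfrac{1-F(x)}{1-F(v^* )}\Big]^mdx$$ (with $y(0,v^* )=r$; terms with $m\ge1$ are read as $0$ if $F(v^* )=1$). *)

theory Defs
  imports "HOL-Probability.Probability"
begin

datatype bidder = Speculator | Seller nat

text \<open>
  Reverse second-price auction with reserve \<open>r\<close>, set of bidders \<open>A\<close> and bids \<open>b\<close>.
  Ties are broken uniformly at random.
\<close>

definition spa_lowest :: "real \<Rightarrow> 'b set \<Rightarrow> ('b \<Rightarrow> real) \<Rightarrow> 'b set" where
  "spa_lowest r A b = {k \<in> A. b k \<le> r \<and> (\<forall>l\<in>A. b k \<le> b l)}"

definition spa_win_prob :: "real \<Rightarrow> 'b set \<Rightarrow> ('b \<Rightarrow> real) \<Rightarrow> 'b \<Rightarrow> real" where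
  "spa_win_prob r A b k =
     (if k \<in> spa_lowest r A b then 1 / real (card (spa_lowest r A b)) else 0)"

definition spa_price :: "real \<Rightarrow> 'b set \<Rightarrow> ('b \<Rightarrow> real) \<Rightarrow> 'b \<Rightarrow> real" where
  "spa_price r A b k = Min (insert r (b ` (A - {k})))"

definition spa_payoff :: "real \<Rightarrow> 'b set \<Rightarrow> ('b \<Rightarrow> real) \<Rightarrow> 'b \<Rightarrow> real \<Rightarrow> real" where
  "spa_payoff r A b k cost = spa_win_prob r A b k * (spa_price r A b k - cost)"

text \<open>
  Stage 2, when \<open>S\<close> is the set of sellers who accepted: the speculator takes part iff he
  acquired an item, and he then offers a single item. The dominant-strategy bids at the value
  profile \<open>w\<close> are the sellers' own values and \<open>0\<close> for the speculator.
\<close>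

definition stage2_bidders :: "nat \<Rightarrow> nat set \<Rightarrow> bidder set" where
  "stage2_bidders N S = Seller ` ({1..N} - S) \<union> (if S = {} then {} else {Speculator})"

fun stage2_bid :: "(nat \<Rightarrow> real) \<Rightarrow> bidder \<Rightarrow> real" where
  "stage2_bid w Speculator = 0"
| "stage2_bid w (Seller i) = w i"

text \<open>
  A stage-1 strategy profile \<open>a\<close> tells whether seller \<open>i\<close> accepts when his value is \<open>v\<close>.
  \<open>M\<close> is the law of a single value.
\<close>

definition accepters :: "nat \<Rightarrow> (nat \<Rightarrow> real \<Rightarrow> bool) \<Rightarrow> (nat \<Rightarrow> real) \<Rightarrow> nat set" where
  "accepters N a w = {j \<in> {1..N}. a j (w j)}"

definition accept_payoff :: "real \<Rightarrow> real \<Rightarrow> real" where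
  "accept_payoff p v = p - v"

definition reject_payoff ::
    "nat \<Rightarrow> real \<Rightarrow> real measure \<Rightarrow> (nat \<Rightarrow> real \<Rightarrow> bool) \<Rightarrow> nat \<Rightarrow> real \<Rightarrow> real" where
  "reject_payoff N r M a i v =
     (\<integral>w. spa_payoff r (stage2_bidders N (accepters N a w - {i}))
            (stage2_bid (w(i := v))) (Seller i) v
       \<partial>(Pi\<^sub>M ({1..N} - {i}) (\<lambda>_. M)))"

definition acceptance_equilibrium ::
    "nat \<Rightarrow> real \<Rightarrow> real measure \<Rightarrow> real \<Rightarrow> (nat \<Rightarrow> real \<Rightarrow> bool) \<Rightarrow> bool" where
  "acceptance_equilibrium N r M p a \<longleftrightarrow>
     (\<forall>i\<in>{1..N}. \<forall>v\<in>{0..1}.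
        (a i v \<longrightarrow> reject_payoff N r M a i v \<le> accept_payoff p v) \<and>
        (\<not> a i v \<longrightarrow> accept_payoff p v \<le> reject_payoff N r M a i v))"

definition cutoff_profile :: "real \<Rightarrow> nat \<Rightarrow> real \<Rightarrow> bool" where
  "cutoff_profile c i v \<longleftrightarrow> v < c"

definition cutoff_equilibrium ::
    "nat \<Rightarrow> real \<Rightarrow> real measure \<Rightarrow> real \<Rightarrow> real \<Rightarrow> bool" where
  "cutoff_equilibrium N r M p c \<longleftrightarrow>
     0 \<le> c \<and> c \<le> r \<and> acceptance_equilibrium N r M p (cutoff_profile c)"

definition speculator_expected_profit ::
    "nat \<Rightarrow> real \<Rightarrow> real measure \<Rightarrow> real \<Rightarrow> (nat \<Rightarrow> real \<Rightarrow> bool) \<Rightarrow> real" where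
  "speculator_expected_profit N r M p a =
     (\<integral>w. spa_payoff r (stage2_bidders N (accepters N a w)) (stage2_bid w) Speculator 0
            - p * real (card (accepters N a w))
       \<partial>(Pi\<^sub>M {1..N} (\<lambda>_. M)))"

text \<open>The closed forms, for a distribution function \<open>F\<close>.\<close>

definition p_star :: "nat \<Rightarrow> real \<Rightarrow> (real \<Rightarrow> real) \<Rightarrow> real \<Rightarrow> real" where
  "p_star N r F v = v + integral {v..r} (\<lambda>x. (1 - F x) ^ (N - 1))"

text \<open>
  For \<open>m = 0\<close> and \<open>v \<le> r\<close> this is \<open>r\<close>, also when \<open>F v = 1\<close>, since \<open>0 ^ 0 = 1\<close>.
\<close>

definition y_star :: "real \<Rightarrow> (real \<Rightarrow> real) \<Rightarrow> nat \<Rightarrow> real \<Rightarrow> real" where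
  "y_star r F m v = v + integral {v..r} (\<lambda>x. ((1 - F x) / (1 - F v)) ^ m)"

text \<open>If \<open>F v = 1\<close>, the factor \<open>(1 - F v) ^ m\<close> makes the terms with \<open>m \<ge> 1\<close> vanish.\<close>

definition Pi_star :: "nat \<Rightarrow> real \<Rightarrow> (real \<Rightarrow> real) \<Rightarrow> real \<Rightarrow> real" where
  "Pi_star N r F v =
     (\<Sum>m = 0..N - 1. real (N choose m) * F v ^ (N - m) * (1 - F v) ^ m * y_star r F m v)
     - real N * F v * p_star N r F v"

end

theory Submission
  imports Defs
begin

text \<open>
  Every payoff in the auction is a truncated excess of a minimum of bids over a level, so by the
  layer-cake formula and Fubini it has expectation \<open>\<integral>(1 - F (max c x)) ^ m dx\<close>. Hence, when the
  others use cutoff \<open>c\<close>, rejecting at value \<open>v\<close> is worth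
  \<open>\<integral>\<^sub>v\<^sup>r (1 - F (max c x)) ^ (N - 1) dx\<close>; since
  \<open>v\<close> plus this integral is nondecreasing in \<open>v\<close> and \<open>p_star\<close> is strictly increasing, the
  offer \<open>p_star c\<close> induces exactly the cutoff \<open>c\<close>.

  Let \<open>q = F c\<close>. The offer \<open>p_star c\<close> nearly equals the resale revenue of a sole acquired item, so
  by Bernoulli's inequality the revenue from that event falls short of the total expected payment
  by at most \<open>N (N - 1) q\<^sup>2 c\<close>, whereas the event of two acquired items brings in
  \<open>(N choose 2) q\<^sup>2\<close> times a quantity that stays bounded away from \<open>0\<close> as \<open>c\<close> tends to \<open>0\<close>.
\<close>

section \<open>Atomless laws on the real line and the probability of a threshold profile\<close>

locale atomless_distribution = real_distribution +
  assumes atomless: "measure M {x} = 0"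
begin

lemma continuous_on_cdf [continuous_intros]:
  assumes "continuous_on A g"
  shows "continuous_on A (\<lambda>x. cdf M (g x))"
proof -
  have "continuous_on UNIV (cdf M)"
    by (simp add: continuous_on_eq_continuous_at isCont_cdf atomless)
  from continuous_on_compose2[OF this assms] show ?thesis by simp
qed

lemma measure_lessThan: "measure M {..<t} = cdf M t"
proof -
  have "measure M {..t} = measure M {..<t} + measure M {t}"
    by (subst finite_measure_Union[symmetric]) (auto intro: arg_cong[where f = "measure M"])
  then show ?thesis by (simp add: cdf_def atomless)
qed

lemma measure_atLeast: "measure M {t..} = 1 - cdf M t"
proof -
  have "{t..} = space M - {..<t}" by auto
  then show ?thesis using prob_compl[of "{..<t}"] by (simp add: measure_lessThan)
qed

lemma cdf_le_1: "cdf M x \<le> 1"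
  by (simp add: cdf_def)

lemma tail_power_bounds: "0 \<le> (1 - cdf M x) ^ n" "(1 - cdf M x) ^ n \<le> 1"
  using cdf_le_1[of x] cdf_nonneg[of x] by (auto intro: power_le_one)

lemma tail_power_antimono: "x \<le> y \<Longrightarrow> (1 - cdf M y) ^ n \<le> (1 - cdf M x) ^ n"
  using cdf_le_1[of y] cdf_nondecreasing[of x y] by (intro power_mono) auto

lemma tail_power_integrable: "(\<lambda>x. (1 - cdf M (max c x)) ^ n) integrable_on {a..b}"
  "(\<lambda>x. (1 - cdf M x) ^ n) integrable_on {a..b}"
  by (intro integrable_continuous_interval continuous_intros)+

text \<open>The event is a box in the product space, so its probability factors over the
  coordinates. Two separate thresholds are kept because the layer-cake argument takes
  \<open>t\<close> to be \<open>max c x\<close>.\<close>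

lemma prob_profile:
  fixes I S :: "'b set"
  assumes "finite I" "S \<subseteq> I"
  shows "measure (Pi\<^sub>M I (\<lambda>_. M))
      {w \<in> space (Pi\<^sub>M I (\<lambda>_. M)). (\<forall>j\<in>S. w j < c) \<and> (\<forall>j\<in>I - S. t \<le> w j)}
    = cdf M c ^ card S * (1 - cdf M t) ^ card (I - S)"
proof -
  interpret P: finite_product_prob_space "\<lambda>_. M" I
    by unfold_locales (use assms in auto)
  let ?X = "\<lambda>j. if j \<in> S then {..<c} else {t..}"
  have "{w \<in> space (Pi\<^sub>M I (\<lambda>_. M)). (\<forall>j\<in>S. w j < c) \<and> (\<forall>j\<in>I - S. t \<le> w j)} = Pi\<^sub>E I ?X"
  proof (intro set_eqI)
    fix w :: "'b \<Rightarrow> real"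
    have "(\<forall>j\<in>S \<union> (I - S). w j \<in> ?X j) \<longleftrightarrow> (\<forall>j\<in>S. w j < c) \<and> (\<forall>j\<in>I - S. t \<le> w j)"
      unfolding ball_Un by (intro arg_cong2[where f = conj] ball_cong) auto
    moreover have "S \<union> (I - S) = I" using assms(2) by auto
    ultimately show "w \<in> {w \<in> space (Pi\<^sub>M I (\<lambda>_. M)). (\<forall>j\<in>S. w j < c) \<and> (\<forall>j\<in>I - S. t \<le> w j)} \<longleftrightarrow>
        w \<in> Pi\<^sub>E I ?X"
      by (auto simp: space_PiM PiE_iff)
  qed
  then have "measure (Pi\<^sub>M I (\<lambda>_. M))
      {w \<in> space (Pi\<^sub>M I (\<lambda>_. M)). (\<forall>j\<in>S. w j < c) \<and> (\<forall>j\<in>I - S. t \<le> w j)}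
      = (\<Prod>j\<in>I. measure M (?X j))"
    by (simp add: P.prob_times)
  also have "\<dots> = (\<Prod>j\<in>S. measure M (?X j)) * (\<Prod>j\<in>I - S. measure M (?X j))"
    using assms by (subst prod.subset_diff[of S]) (auto simp: mult.commute)
  also have "\<dots> = cdf M c ^ card S * (1 - cdf M t) ^ card (I - S)"
    by (simp add: measure_lessThan measure_atLeast)
  finally show ?thesis .
qed

end

section \<open>Expected truncated surplus over a threshold event\<close>

definition lowest_bid :: "real \<Rightarrow> 'i set \<Rightarrow> ('i \<Rightarrow> real) \<Rightarrow> real" where
  "lowest_bid r J w = Min (insert r (w ` J))"

lemma le_lowest_bid_iff: "finite J \<Longrightarrow> x \<le> lowest_bid r J w \<longleftrightarrow> x \<le> r \<and> (\<forall>j\<in>J. x \<le> w j)"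
  by (auto simp: lowest_bid_def)

text \<open>
  With \<open>S\<close> the accepting sellers and \<open>T\<close> the rejecting ones, \<open>a = 0\<close> gives the speculator's revenue;
  with \<open>S = {}\<close> and \<open>T\<close> the competitors, \<open>a = v\<close> gives a seller's payoff from rejecting.
\<close>

definition surplus :: "real \<Rightarrow> 'i set \<Rightarrow> 'i set \<Rightarrow> real \<Rightarrow> real \<Rightarrow> ('i \<Rightarrow> real) \<Rightarrow> real" where
  "surplus r S T c a w =
     (if (\<forall>j\<in>S. w j < c) \<and> (\<forall>j\<in>T. c \<le> w j) then max 0 (lowest_bid r T w - a) else 0)"

text \<open>The surplus is the length of the interval of levels between \<open>a\<close> and the
  lowest bid. The bound \<open>max c x\<close> merges the rejection condition with the condition
  that the level lies below every bid, so that for fixed \<open>x\<close> a single threshold event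
  remains.\<close>

lemma surplus_layer_cake:
  assumes "finite T"
  shows "surplus r S T c a w =
    (\<integral>x. indicator {x. a \<le> x \<and> x \<le> r \<and> (\<forall>j\<in>S. w j < c) \<and> (\<forall>j\<in>T. max c x \<le> w j)} x \<partial>lborel)"
proof (cases "(\<forall>j\<in>S. w j < c) \<and> (\<forall>j\<in>T. c \<le> w j)")
  case True
  then have "{x. a \<le> x \<and> x \<le> r \<and> (\<forall>j\<in>S. w j < c) \<and> (\<forall>j\<in>T. max c x \<le> w j)} = {a..lowest_bid r T w}"
    using assms by (auto simp: le_lowest_bid_iff)
  then show ?thesis using True by (simp add: surplus_def)
next
  case False
  then have "{x. a \<le> x \<and> x \<le> r \<and> (\<forall>j\<in>S. w j < c) \<and> (\<forall>j\<in>T. max c x \<le> w j)} = {}"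
    by auto
  then show ?thesis using False by (auto simp: surplus_def)
qed

context atomless_distribution
begin

text \<open>Fubini swaps level and profile; for a fixed level \<open>x\<close> the inner integral is
  the probability of a threshold profile with upper threshold \<open>max c x\<close>.\<close>

lemma
  assumes "finite I" "S \<subseteq> I"
  shows surplus_integrable: "integrable (Pi\<^sub>M I (\<lambda>_. M)) (surplus r S (I - S) c a)"
    and expected_surplus: "(\<integral>w. surplus r S (I - S) c a w \<partial>Pi\<^sub>M I (\<lambda>_. M)) =
      cdf M c ^ card S * integral {a..r} (\<lambda>x. (1 - cdf M (max c x)) ^ card (I - S))"
proof -
  let ?P = "Pi\<^sub>M I (\<lambda>_. M)" and ?T = "I - S"
  interpret P: finite_product_prob_space "\<lambda>_. M" I
    by unfold_locales (use assms in auto)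
  interpret PL: pair_sigma_finite ?P "lborel :: real measure" ..
  let ?Q = "\<lambda>w x. a \<le> x \<and> x \<le> r \<and> (\<forall>j\<in>S. w j < c) \<and> (\<forall>j\<in>?T. max c x \<le> w j)"
  let ?E = "{z \<in> space (?P \<Otimes>\<^sub>M lborel). ?Q (fst z) (snd z)}"
  let ?h = "\<lambda>w x. indicator {x. ?Q w x} x :: real"
  have fin: "finite S" "finite ?T" using assms by (auto intro: finite_subset)
  have [measurable]: "(\<lambda>z. fst z j) \<in> borel_measurable (?P \<Otimes>\<^sub>M lborel)" if "j \<in> I" for j
    using that by (intro measurable_compose[OF measurable_fst]) simp
  have E: "?E \<in> sets (?P \<Otimes>\<^sub>M lborel)"
  proof (intro sets.sets_Collect_finite_All sets.sets_Collect_conj fin)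
    show "{z \<in> space (?P \<Otimes>\<^sub>M lborel). fst z j < c} \<in> sets (?P \<Otimes>\<^sub>M lborel)" if "j \<in> S" for j
    proof -
      have [measurable]: "j \<in> I" using that assms by auto
      show ?thesis by measurable
    qed
    show "{z \<in> space (?P \<Otimes>\<^sub>M lborel). max c (snd z) \<le> fst z j} \<in> sets (?P \<Otimes>\<^sub>M lborel)"
      if "j \<in> ?T" for j
    proof -
      have [measurable]: "j \<in> I" using that by auto
      show ?thesis by measurable
    qed
  qed measurable
  \<comment> \<open>Levels are confined to a bounded interval and \<open>?P\<close> is a probability
    measure, so \<open>?E\<close> has finite measure and its indicator is integrable.\<close>
  have "emeasure (?P \<Otimes>\<^sub>M lborel) ?E \<le> emeasure (?P \<Otimes>\<^sub>M lborel) (space ?P \<times> {a..r})"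
    by (intro emeasure_mono) (auto simp: space_pair_measure)
  also have "\<dots> = emeasure lborel {a..r}"
    by (subst lborel.emeasure_pair_measure_Times) (auto simp: P.emeasure_space_1)
  also have "\<dots> < \<infinity>" by (simp add: emeasure_lborel_Icc_eq)
  finally have intE: "integrable (?P \<Otimes>\<^sub>M lborel) (indicator ?E :: _ \<Rightarrow> real)"
    using E by (intro integrable_real_indicator)
  have "indicator ?E z = case_prod ?h z" if "z \<in> space (?P \<Otimes>\<^sub>M lborel)" for z
    using that by (cases z) (simp only: indicator_def mem_Collect_eq case_prod_conv fst_conv snd_conv simp_thms)
  then have int: "integrable (?P \<Otimes>\<^sub>M lborel) (case_prod ?h)"
    using intE Bochner_Integration.integrable_cong[OF refl, of "?P \<Otimes>\<^sub>M lborel" "indicator ?E" "case_prod ?h"]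
    by blast
  have cake: "surplus r S ?T c a = (\<lambda>w. \<integral>x. ?h w x \<partial>lborel)"
    using fin by (intro ext surplus_layer_cake)
  show "integrable ?P (surplus r S ?T c a)"
    unfolding cake by (rule PL.integrable_fst[OF int])
  have "(\<integral>w. surplus r S ?T c a w \<partial>?P) = (\<integral>w. \<integral>x. ?h w x \<partial>lborel \<partial>?P)"
    by (simp add: cake)
  also have "\<dots> = (\<integral>x. \<integral>w. ?h w x \<partial>?P \<partial>lborel)"
    by (rule PL.Fubini_integral[OF int, symmetric])
  also have "\<dots> = (\<integral>x. indicator {a..r} x *\<^sub>R
      (cdf M c ^ card S * (1 - cdf M (max c x)) ^ card ?T) \<partial>lborel)"
  proof (intro Bochner_Integration.integral_cong refl)
    fix x :: real
    have "(\<integral>w. ?h w x \<partial>?P) = (\<integral>w. indicator {a..r} x *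
        indicator {w \<in> space ?P. (\<forall>j\<in>S. w j < c) \<and> (\<forall>j\<in>?T. max c x \<le> w j)} w \<partial>?P)"
      by (intro Bochner_Integration.integral_cong refl) (auto simp: indicator_def)
    also have "\<dots> = indicator {a..r} x *
        measure ?P {w \<in> space ?P. (\<forall>j\<in>S. w j < c) \<and> (\<forall>j\<in>?T. max c x \<le> w j)}"
    proof -
      have "{w \<in> space ?P. Q w} \<inter> space ?P = {w \<in> space ?P. Q w}" for Q by auto
      then show ?thesis by (simp only: integral_mult_right_zero Bochner_Integration.integral_indicator)
    qed
    finally show "(\<integral>w. ?h w x \<partial>?P) = indicator {a..r} x *\<^sub>R
      (cdf M c ^ card S * (1 - cdf M (max c x)) ^ card ?T)"
      by (simp only: prob_profile[OF assms] real_scaleR_def)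
  qed
  also have "\<dots> = integral {a..r} (\<lambda>x. cdf M c ^ card S * (1 - cdf M (max c x)) ^ card ?T)"
    unfolding set_lebesgue_integral_def[symmetric]
    by (intro set_borel_integral_eq_integral borel_integrable_atLeastAtMost' continuous_intros)
  finally show "(\<integral>w. surplus r S ?T c a w \<partial>?P) =
      cdf M c ^ card S * integral {a..r} (\<lambda>x. (1 - cdf M (max c x)) ^ card ?T)"
    by simp
qed

lemma expected_accepters:
  "integrable (Pi\<^sub>M {1..N} (\<lambda>_. M)) (\<lambda>w. real (card (accepters N (cutoff_profile c) w)))"
  "(\<integral>w. real (card (accepters N (cutoff_profile c) w)) \<partial>Pi\<^sub>M {1..N} (\<lambda>_. M)) = real N * cdf M c"
proof -
  let ?P = "Pi\<^sub>M {1..N} (\<lambda>_. M)"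
  interpret P: finite_product_prob_space "\<lambda>_. M" "{1..N}"
    by unfold_locales auto
  have card: "real (card (accepters N (cutoff_profile c) w)) = (\<Sum>j\<in>{1..N}. indicator {..<c} (w j))" for w
    by (simp add: accepters_def cutoff_profile_def indicator_def sum.If_cases Int_def)
  have int: "integrable ?P (\<lambda>w. indicator {..<c} (w j) :: real)"
    and val: "(\<integral>w. (indicator {..<c} (w j) :: real) \<partial>?P) = cdf M c" if "j \<in> {1..N}" for j
  proof -
    have [measurable]: "(\<lambda>w. w j) \<in> measurable ?P M"
      using that by (rule measurable_component_singleton)
    show "integrable ?P (\<lambda>w. indicator {..<c} (w j) :: real)"
      by (rule P.integrable_const_bound[where B = 1], simp add: indicator_def)
         (use that in measurable)
    have "(\<integral>w. (indicator {..<c} (w j) :: real) \<partial>?P) = (\<integral>v. indicator {..<c} v \<partial>distr ?P M (\<lambda>w. w j))"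
      by (subst integral_distr) (use that in simp_all)
    also have "\<dots> = cdf M c"
      by (simp only: P.PiM_component[OF that]) (simp add: measure_lessThan)
    finally show "(\<integral>w. (indicator {..<c} (w j) :: real) \<partial>?P) = cdf M c" .
  qed
  show "integrable ?P (\<lambda>w. real (card (accepters N (cutoff_profile c) w)))"
    unfolding card by (intro Bochner_Integration.integrable_sum int)
  show "(\<integral>w. real (card (accepters N (cutoff_profile c) w)) \<partial>?P) = real N * cdf M c"
    unfolding card by (simp only: Bochner_Integration.integral_sum[OF int] sum.cong[OF refl val]) simp
qed

end

section \<open>Auction payoffs at a fixed value profile\<close>

text \<open>If some other seller accepted, the speculator's bid of 0 leaves seller \<open>i\<close>
  no gain. Otherwise all rivals have values at least \<open>c\<close>, and the payoff is the excess
  of the lowest rival bid, capped by the reserve, over \<open>v\<close>.\<close>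

lemma reject_payoff_pointwise:
  assumes "0 \<le> c" "0 \<le> v" "i \<in> {1..N}"
  shows "spa_payoff r (stage2_bidders N (accepters N (cutoff_profile c) w - {i}))
      (stage2_bid (w(i := v))) (Seller i) v = surplus r {} ({1..N} - {i}) c v w"
proof -
  let ?J = "{1..N} - {i}" and ?b = "stage2_bid (w(i := v))"
  define S where "S = accepters N (cutoff_profile c) w - {i}"
  define A where "A = stage2_bidders N S"
  have S: "S = {j \<in> ?J. w j < c}"
    by (auto simp: S_def accepters_def cutoff_profile_def)
  have "spa_payoff r A ?b (Seller i) v = surplus r {} ?J c v w"
  proof (cases "S = {}")
    case True
    then have A: "A = Seller ` {1..N}" by (simp add: A_def stage2_bidders_def)
    have "?b ` (A - {Seller i}) = w ` ?J"
      by (force simp: A)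
    then have price: "spa_price r A ?b (Seller i) = lowest_bid r ?J w"
      by (simp add: spa_price_def lowest_bid_def)
    have low: "Seller i \<in> spa_lowest r A ?b \<longleftrightarrow> v \<le> lowest_bid r ?J w"
      using assms by (auto simp: spa_lowest_def A le_lowest_bid_iff)
    have sole: "spa_lowest r A ?b = {Seller i}" if "v < lowest_bid r ?J w"
    proof -
      have "v < w j" if "j \<in> ?J" for j
        using \<open>v < lowest_bid r ?J w\<close> le_lowest_bid_iff[of ?J "lowest_bid r ?J w" r w] that by force
      then have "k = Seller i" if "k \<in> spa_lowest r A ?b" for k
        using that assms(3) by (force simp: spa_lowest_def A split: if_splits)
      moreover have "Seller i \<in> spa_lowest r A ?b" using low that by simp
      ultimately show ?thesis by blast
    qed
    have "spa_payoff r A ?b (Seller i) v = max 0 (lowest_bid r ?J w - v)"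
    proof (cases "v < lowest_bid r ?J w")
      case True
      then have "spa_lowest r A ?b = {Seller i}" by (rule sole)
      then show ?thesis using True by (simp add: spa_payoff_def spa_win_prob_def price)
    next
      case False
      then consider "Seller i \<notin> spa_lowest r A ?b" | "lowest_bid r ?J w = v"
        using low by linarith
      then show ?thesis
      proof cases
        case 1
        then show ?thesis using False by (simp add: spa_payoff_def spa_win_prob_def)
      next
        \<comment> \<open>In a tie the price equals the seller's own value, so the random
          tie-breaking does not affect the payoff.\<close>
        case 2
        then show ?thesis by (simp add: spa_payoff_def price)
      qed
    qed
    moreover have "\<forall>j\<in>?J. c \<le> w j" using True by (force simp: S)
    ultimately show ?thesis by (simp add: surplus_def)
  next
    case False
    then have spec: "Speculator \<in> A - {Seller i}" by (simp add: A_def stage2_bidders_def)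
    have fin: "finite A" by (simp add: A_def stage2_bidders_def)
    have nonneg: "0 \<le> ?b k" if "k \<in> A - {Seller i}" for k
      using that assms by (auto simp: A_def stage2_bidders_def S not_less split: if_splits)
    \<comment> \<open>Against a bid of 0 the seller can win only with value 0, in a tie, and is then
      paid 0.\<close>
    have "spa_win_prob r A ?b (Seller i) * (spa_price r A ?b (Seller i) - v) = 0"
    proof (cases "Seller i \<in> spa_lowest r A ?b")
      case True
      then have "v \<le> r" "v \<le> ?b Speculator" using spec by (auto simp: spa_lowest_def)
      then have v: "v = 0" "0 \<le> r" using assms(2) by auto
      have "Min (insert r (?b ` (A - {Seller i}))) = 0"
        using spec v nonneg fin by (intro Min_eqI) (auto intro: rev_image_eqI)
      then show ?thesis by (simp add: spa_price_def v)
    qed (simp add: spa_win_prob_def)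
    moreover have "\<not> (\<forall>j\<in>?J. c \<le> w j)" using False by (force simp: S)
    ultimately show ?thesis by (auto simp: spa_payoff_def surplus_def)
  qed
  then show ?thesis by (simp add: A_def S_def)
qed

text \<open>The events for different sets \<open>S\<close> partition the profiles, so only the
  summand of the actual accepters survives. Since \<open>c\<close> is positive, every rejecter bids
  above 0 and the speculator wins without a tie.\<close>

lemma speculator_payoff_pointwise:
  assumes "0 < c" "0 < r"
  shows "spa_payoff r (stage2_bidders N (accepters N (cutoff_profile c) w)) (stage2_bid w) Speculator 0
    = (\<Sum>S\<in>Pow {1..N} - {{}}. surplus r S ({1..N} - S) c 0 w)"
proof -
  define S where "S = accepters N (cutoff_profile c) w"
  define A where "A = stage2_bidders N S"
  let ?T = "{1..N} - S" and ?b = "stage2_bid w"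
  have S: "S = {j \<in> {1..N}. w j < c}"
    by (auto simp: S_def accepters_def cutoff_profile_def)
  have "surplus r S' ({1..N} - S') c 0 w = (if S' = S then lowest_bid r ?T w else 0)"
    if "S' \<in> Pow {1..N} - {{}}" for S'
  proof (cases "S' = S")
    case True
    have "0 \<le> lowest_bid r ?T w"
      using assms by (force simp: le_lowest_bid_iff S)
    then show ?thesis using True by (auto simp: surplus_def S)
  next
    case False
    then have "\<not> ((\<forall>j\<in>S'. w j < c) \<and> (\<forall>j\<in>{1..N} - S'. c \<le> w j))"
      using that by (force simp: S)
    then show ?thesis using False by (auto simp: surplus_def)
  qed
  then have "(\<Sum>S'\<in>Pow {1..N} - {{}}. surplus r S' ({1..N} - S') c 0 w) =
      (\<Sum>S'\<in>Pow {1..N} - {{}}. if S' = S then lowest_bid r ?T w else 0)"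
    by (rule sum.cong[OF refl])
  also have "\<dots> = (if S = {} then 0 else lowest_bid r ?T w)"
    by (subst sum.delta) (auto simp: S)
  also have "\<dots> = spa_payoff r A ?b Speculator 0"
  proof (cases "S = {}")
    case True
    then show ?thesis
      by (auto simp: spa_payoff_def spa_win_prob_def spa_lowest_def A_def stage2_bidders_def)
  next
    case False
    then have A: "A = insert Speculator (Seller ` ?T)" by (auto simp: A_def stage2_bidders_def)
    have pos: "0 < w j" if "j \<in> ?T" for j using that assms by (auto simp: S)
    then have "spa_lowest r A ?b = {Speculator}"
      using assms by (force simp: spa_lowest_def A)
    moreover have "?b ` (A - {Speculator}) = w ` ?T"
      by (force simp: A)
    then have "spa_price r A ?b Speculator = lowest_bid r ?T w"
      by (simp add: spa_price_def lowest_bid_def)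
    ultimately show ?thesis using False
      by (simp add: spa_payoff_def spa_win_prob_def)
  qed
  finally show ?thesis by (simp add: A_def S_def)
qed

text \<open>Turns the sum over sets of accepters into the binomial sum of
  \<open>Pi_star\<close>.\<close>

lemma sum_nonempty_subsets_by_card:
  fixes g :: "nat \<Rightarrow> real"
  assumes "finite I"
  shows "(\<Sum>S\<in>Pow I - {{}}. g (card S)) = (\<Sum>k\<in>{1..card I}. real (card I choose k) * g k)"
proof -
  have "(\<Sum>S\<in>Pow I - {{}}. g (card S)) =
      (\<Sum>k\<in>{1..card I}. \<Sum>S\<in>{S \<in> Pow I - {{}}. card S = k}. g (card S))"
  proof (rule sum.group[symmetric])
    have "1 \<le> card S \<and> card S \<le> card I" if "S \<in> Pow I - {{}}" for S
      using that assms finite_subset[of S I] by (auto simp: Suc_le_eq card_gt_0_iff intro: card_mono)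
    then show "card ` (Pow I - {{}}) \<subseteq> {1..card I}" by (intro image_subsetI) simp
  qed (use assms in auto)
  also have "\<dots> = (\<Sum>k\<in>{1..card I}. real (card I choose k) * g k)"
  proof (rule sum.cong[OF refl])
    fix k assume "k \<in> {1..card I}"
    then have "{S \<in> Pow I - {{}}. card S = k} = {S. S \<subseteq> I \<and> card S = k}" by auto
    then show "(\<Sum>S\<in>{S \<in> Pow I - {{}}. card S = k}. g (card S)) = real (card I choose k) * g k"
      using assms by (simp add: n_subsets)
  qed
  finally show ?thesis .
qed

section \<open>Closed forms of the expected payoffs\<close>

context atomless_distribution
begin

lemma reject_payoff_eq:
  assumes "0 \<le> c" "0 \<le> v" "i \<in> {1..N}"
  shows "reject_payoff N r M (cutoff_profile c) i v =
    integral {v..r} (\<lambda>x. (1 - cdf M (max c x)) ^ (N - 1))"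
  using assms expected_surplus[of "{1..N} - {i}" "{}" r c v]
  by (simp add: reject_payoff_def reject_payoff_pointwise)

text \<open>Below \<open>c\<close> the integrand is constant; above \<open>c\<close> the normalising
  factor of \<open>y_star\<close> is pulled out, which is possible since
  \<open>cdf M c < 1\<close>.\<close>

lemma integral_tail_split:
  assumes "0 \<le> c" "c \<le> r" "cdf M c < 1"
  shows "integral {0..r} (\<lambda>x. (1 - cdf M (max c x)) ^ m) = (1 - cdf M c) ^ m * y_star r (cdf M) m c"
proof -
  have "integral {0..r} (\<lambda>x. (1 - cdf M (max c x)) ^ m) =
      integral {0..c} (\<lambda>x. (1 - cdf M (max c x)) ^ m) + integral {c..r} (\<lambda>x. (1 - cdf M (max c x)) ^ m)"
    using assms by (intro Henstock_Kurzweil_Integration.integral_combine[symmetric] tail_power_integrable) auto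
  also have "integral {0..c} (\<lambda>x. (1 - cdf M (max c x)) ^ m) = integral {0..c} (\<lambda>x. (1 - cdf M c) ^ m)"
    by (intro Henstock_Kurzweil_Integration.integral_cong) (auto simp: max_def)
  also have "integral {c..r} (\<lambda>x. (1 - cdf M (max c x)) ^ m) =
      integral {c..r} (\<lambda>x. (1 - cdf M c) ^ m * ((1 - cdf M x) / (1 - cdf M c)) ^ m)"
    using assms by (intro Henstock_Kurzweil_Integration.integral_cong) (auto simp: max_def power_divide)
  finally show ?thesis using assms by (simp add: y_star_def algebra_simps)
qed

lemma speculator_expected_profit_eq:
  assumes "1 \<le> N" "0 < c" "c \<le> r" "cdf M c < 1"
  shows "speculator_expected_profit N r M (p_star N r (cdf M) c) (cutoff_profile c) = Pi_star N r (cdf M) c"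
proof -
  let ?P = "Pi\<^sub>M {1..N} (\<lambda>_. M)" and ?p = "p_star N r (cdf M) c"
  let ?g = "\<lambda>k. cdf M c ^ k * ((1 - cdf M c) ^ (N - k) * y_star r (cdf M) (N - k) c)"
  have int: "integrable ?P (surplus r S ({1..N} - S) c 0)" if "S \<in> Pow {1..N} - {{}}" for S
    using that by (intro surplus_integrable) auto
  have val: "(\<integral>w. surplus r S ({1..N} - S) c 0 w \<partial>?P) = ?g (card S)" if "S \<in> Pow {1..N} - {{}}" for S
    using that assms by (subst expected_surplus)
      (auto simp: integral_tail_split card_Diff_subset finite_subset)
  have "speculator_expected_profit N r M ?p (cutoff_profile c) =
      (\<integral>w. (\<Sum>S\<in>Pow {1..N} - {{}}. surplus r S ({1..N} - S) c 0 w)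
        - ?p * real (card (accepters N (cutoff_profile c) w)) \<partial>?P)"
    using assms by (simp add: speculator_expected_profit_def speculator_payoff_pointwise)
  also have "\<dots> = (\<Sum>S\<in>Pow {1..N} - {{}}. ?g (card S)) - ?p * (real N * cdf M c)"
  proof (subst Bochner_Integration.integral_diff)
    show "integrable ?P (\<lambda>w. \<Sum>S\<in>Pow {1..N} - {{}}. surplus r S ({1..N} - S) c 0 w)"
      by (intro Bochner_Integration.integrable_sum int)
    show "integrable ?P (\<lambda>w. ?p * real (card (accepters N (cutoff_profile c) w)))"
      by (intro integrable_mult_right expected_accepters)
    show "(\<integral>w. (\<Sum>S\<in>Pow {1..N} - {{}}. surplus r S ({1..N} - S) c 0 w) \<partial>?P) -
        (\<integral>w. ?p * real (card (accepters N (cutoff_profile c) w)) \<partial>?P) =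
        (\<Sum>S\<in>Pow {1..N} - {{}}. ?g (card S)) - ?p * (real N * cdf M c)"
      by (simp only: Bochner_Integration.integral_sum[OF int] sum.cong[OF refl val]
          integral_mult_right_zero expected_accepters)
  qed
  also have "(\<Sum>S\<in>Pow {1..N} - {{}}. ?g (card S)) = (\<Sum>k\<in>{1..N}. real (N choose k) * ?g k)"
    by (subst sum_nonempty_subsets_by_card) simp_all
  \<comment> \<open>\<open>k\<close> counts accepters whereas the index of \<open>Pi_star\<close>
    counts rejecters; excluding \<open>k = 0\<close> is excluding \<open>m = N\<close>.\<close>
  also have "\<dots> = (\<Sum>m = 0..N - 1. real (N choose m) * ?g (N - m))"
    by (rule sum.reindex_bij_witness[of _ "\<lambda>m. N - m" "\<lambda>k. N - k"])
       (use assms(1) in \<open>auto simp: binomial_symmetric[symmetric]\<close>)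
  also have "\<dots> = (\<Sum>m = 0..N - 1. real (N choose m) * cdf M c ^ (N - m) * (1 - cdf M c) ^ m * y_star r (cdf M) m c)"
    by (intro sum.cong) (auto simp: mult_ac)
  finally show ?thesis by (simp add: Pi_star_def mult_ac)
qed

section \<open>Cutoff equilibria: existence and uniqueness for the offer
  \<open>p_star\<close>\<close>

lemma integral_tail_le:
  assumes "a \<le> b"
  shows "integral {a..b} (\<lambda>x. (1 - cdf M (max c x)) ^ n) \<le> b - a"
proof -
  have "integral {a..b} (\<lambda>x. (1 - cdf M (max c x)) ^ n) \<le> integral {a..b} (\<lambda>x. 1)"
    by (intro integral_le tail_power_integrable tail_power_bounds) auto
  then show ?thesis using assms by simp
qed

text \<open>The integrand is at most 1, so raising the lower limit to \<open>v'\<close> costs at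
  most \<open>v' - v\<close>. Values above the reserve are included, where the integral is
  0.\<close>

lemma value_plus_reject_mono:
  assumes "v \<le> v'"
  shows "v + integral {v..r} (\<lambda>x. (1 - cdf M (max c x)) ^ n)
    \<le> v' + integral {v'..r} (\<lambda>x. (1 - cdf M (max c x)) ^ n)"
proof -
  let ?H = "\<lambda>x. (1 - cdf M (max c x)) ^ n"
  consider "v' \<le> r" | "v \<le> r" "r < v'" | "r < v" by linarith
  then show ?thesis
  proof cases
    case 1
    have "integral {v..v'} ?H + integral {v'..r} ?H = integral {v..r} ?H"
      by (intro Henstock_Kurzweil_Integration.integral_combine tail_power_integrable assms 1)
    then show ?thesis using integral_tail_le[OF assms, of c n] by linarith
  next
    case 2
    then show ?thesis using integral_tail_le[OF 2(1), of c n] by simp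
  next
    case 3
    then show ?thesis using assms by simp
  qed
qed

lemma p_star_eq: "p_star N r (cdf M) c = c + integral {c..r} (\<lambda>x. (1 - cdf M (max c x)) ^ (N - 1))"
  unfolding p_star_def
  by (intro arg_cong2[where f = "(+)"] refl Henstock_Kurzweil_Integration.integral_cong) (auto simp: max_def)

lemma p_star_in_Icc:
  assumes "0 \<le> c" "c \<le> r"
  shows "p_star N r (cdf M) c \<in> {0..r}"
proof -
  have "0 \<le> integral {c..r} (\<lambda>x. (1 - cdf M (max c x)) ^ (N - 1))"
    by (intro integral_nonneg tail_power_integrable tail_power_bounds)
  then show ?thesis
    using integral_tail_le[OF assms(2), of c "N - 1"] assms by (simp add: p_star_eq)
qed

text \<open>Raising the cutoff adds \<open>c' - c\<close> and removes the integral over the gap,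
  which is smaller because the integrand is below 1 wherever the CDF is positive.\<close>

lemma p_star_strict_mono:
  assumes "2 \<le> N" "0 \<le> c" "c < c'" "c' \<le> r" and pos: "\<And>v. 0 < v \<Longrightarrow> v \<le> r \<Longrightarrow> 0 < cdf M v"
  shows "p_star N r (cdf M) c < p_star N r (cdf M) c'"
proof -
  let ?H = "\<lambda>x. (1 - cdf M x) ^ (N - 1)"
  \<comment> \<open>At \<open>c = 0\<close> the CDF may vanish, so the strict bound is taken at an
    interior point and extended to its right by monotonicity.\<close>
  define z where "z = (c + c') / 2"
  have z: "c < z" "z < c'" using assms by (auto simp: z_def)
  have "integral {c..z} ?H \<le> integral {c..z} (\<lambda>x. 1)"
    by (intro integral_le tail_power_integrable tail_power_bounds) auto
  then have left: "integral {c..z} ?H \<le> z - c"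
    using z by simp
  have "integral {z..c'} ?H \<le> integral {z..c'} (\<lambda>x. ?H z)"
    by (intro integral_le tail_power_integrable tail_power_antimono) auto
  then have right: "integral {z..c'} ?H \<le> (c' - z) * ?H z"
    using z by simp
  have "?H z < 1"
    using pos[of z] cdf_le_1[of z] z assms by (simp add: power_less_one_iff)
  then have gap: "(c' - z) * ?H z < c' - z" using z by simp
  have "integral {c..z} ?H + integral {z..c'} ?H = integral {c..c'} ?H"
    using z by (intro Henstock_Kurzweil_Integration.integral_combine tail_power_integrable) auto
  moreover have "integral {c..c'} ?H + integral {c'..r} ?H = integral {c..r} ?H"
    using assms by (intro Henstock_Kurzweil_Integration.integral_combine tail_power_integrable) auto
  ultimately show ?thesis
    unfolding p_star_def using left right gap by linarith
qed

text \<open>The seller with value \<open>c\<close> is indifferent at this offer, and value plus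
  worth of rejecting is nondecreasing: lower values weakly prefer to accept, higher ones to
  reject.\<close>

lemma cutoff_equilibrium_p_star:
  assumes "0 \<le> c" "c \<le> r"
  shows "cutoff_equilibrium N r M (p_star N r (cdf M) c) c"
  using assms value_plus_reject_mono[of _ c r c "N - 1"] value_plus_reject_mono[of c _ r c "N - 1"]
  by (auto simp: cutoff_equilibrium_def acceptance_equilibrium_def accept_payoff_def reject_payoff_eq
      cutoff_profile_def p_star_eq algebra_simps not_less)

text \<open>Acceptance is strict below the cutoff, so a seller with value exactly \<open>c\<close>
  rejects; his incentive condition is the claim.\<close>

lemma cutoff_equilibrium_upper:
  assumes "cutoff_equilibrium N r M p c" "1 \<le> N" "r \<le> 1"
  shows "p \<le> p_star N r (cdf M) c"
proof -
  have "0 \<le> c" "c \<le> 1" and eq: "acceptance_equilibrium N r M p (cutoff_profile c)"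
    using assms by (auto simp: cutoff_equilibrium_def)
  then have "accept_payoff p c \<le> reject_payoff N r M (cutoff_profile c) 1 c"
    using assms(2) by (auto simp: acceptance_equilibrium_def cutoff_profile_def)
  then show ?thesis
    using \<open>0 \<le> c\<close> assms(2) by (simp add: accept_payoff_def reject_payoff_eq p_star_eq)
qed

text \<open>A seller with value just below the cutoff accepts, so the offer cannot fall short of
  \<open>p_star\<close> by more than the distance of that value from the cutoff.\<close>

lemma cutoff_equilibrium_lower:
  assumes "cutoff_equilibrium N r M p c" "0 < c" "1 \<le> N" "r \<le> 1"
  shows "p_star N r (cdf M) c \<le> p"
proof (rule field_le_epsilon)
  fix e :: real assume "0 < e"
  let ?H = "\<lambda>x. (1 - cdf M (max c x)) ^ (N - 1)"
  define v where "v = max 0 (c - e)"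
  have c: "c \<le> r" and eq: "acceptance_equilibrium N r M p (cutoff_profile c)"
    using assms by (auto simp: cutoff_equilibrium_def)
  have v: "0 \<le> v" "v < c" "c - e \<le> v" using \<open>0 < e\<close> assms(2) by (auto simp: v_def)
  then have "reject_payoff N r M (cutoff_profile c) 1 v \<le> accept_payoff p v"
    using eq assms c by (auto simp: acceptance_equilibrium_def cutoff_profile_def)
  then have "integral {v..r} ?H \<le> p - v"
    using v assms by (simp add: accept_payoff_def reject_payoff_eq)
  moreover have "integral {c..r} ?H \<le> integral {v..r} ?H"
    using v by (intro integral_subset_le tail_power_integrable ballI tail_power_bounds) auto
  ultimately show "p_star N r (cdf M) c \<le> p + e"
    using v by (simp add: p_star_eq)
qed

text \<open>A smaller cutoff contradicts the upper bound on the offer, which also covers the cutoff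
  0; a larger one is positive and contradicts the lower bound.\<close>

lemma cutoff_equilibrium_unique:
  assumes "2 \<le> N" "0 < c" "c \<le> r" "r \<le> 1" and pos: "\<And>v. 0 < v \<Longrightarrow> v \<le> r \<Longrightarrow> 0 < cdf M v"
    and eq: "cutoff_equilibrium N r M (p_star N r (cdf M) c) c'"
  shows "c' = c"
proof (rule linorder_cases)
  have c': "0 \<le> c'" "c' \<le> r" using eq by (auto simp: cutoff_equilibrium_def)
  {
    assume "c' < c"
    then have "p_star N r (cdf M) c' < p_star N r (cdf M) c"
      using assms c' by (intro p_star_strict_mono) auto
    with cutoff_equilibrium_upper[OF eq] show ?thesis using assms by simp
  next
    assume "c < c'"
    then have "p_star N r (cdf M) c < p_star N r (cdf M) c'"
      using assms c' by (intro p_star_strict_mono) auto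
    with cutoff_equilibrium_lower[OF eq] show ?thesis using assms \<open>c < c'\<close> by simp
  }
qed

section \<open>Positive profit at a small cutoff\<close>

text \<open>The scale of \<open>c\<close> makes two acquired items worth at least
  \<open>4 * c\<close>, so that event contributes at least \<open>2 * N * (N - 1) * q^2 * c\<close>,
  twice the bound on the shortfall from a sole acquired item.\<close>

lemma Pi_star_pos:
  assumes "2 \<le> N" "0 < d" "d \<le> r" "cdf M d \<le> 1 / 2" and c: "c = d / 2 ^ (N + 1)" and pos: "0 < cdf M c"
  shows "0 < Pi_star N r (cdf M) c"
proof -
  obtain n where N: "N = Suc (Suc n)" using assms(1) by (metis Suc_le_D numeral_2_eq_2 Suc_le_mono)
  define q where "q = cdf M c"
  define I where "I m = integral {c..r} (\<lambda>x. (1 - cdf M x) ^ m)" for m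
  have "(1::real) \<le> 4 * 2 ^ n" using one_le_power[of "2::real" n] by linarith
  then have cd: "0 < c" "c \<le> d / 2" using assms(2) by (auto simp: c N field_simps)
  have q: "0 < q" "q < 1"
    using pos assms cdf_nondecreasing[of c d] cd by (auto simp: q_def)
  have G: "(1 - q) ^ m * y_star r (cdf M) m c = c * (1 - q) ^ m + I m" for m
  proof -
    have "I m = integral {c..r} (\<lambda>x. (1 - q) ^ m * ((1 - cdf M x) / (1 - q)) ^ m)"
      unfolding I_def using q by (intro Henstock_Kurzweil_Integration.integral_cong) (simp add: power_divide)
    then show ?thesis by (simp add: y_star_def q_def algebra_simps)
  qed
  have I_nonneg: "0 \<le> I m" for m
    unfolding I_def by (intro integral_nonneg tail_power_integrable tail_power_bounds)
  \<comment> \<open>On the upper half of \<open>{0..d}\<close>, which lies to the right of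
    \<open>c\<close>, the tail is at least 1/2; this bounds \<open>I n\<close> below.\<close>
  have "d / 2 * (1 / 2) ^ n = integral {d / 2..d} (\<lambda>x. (1 / 2) ^ n)"
    using assms(2) by simp
  also have "\<dots> \<le> integral {d / 2..d} (\<lambda>x. (1 - cdf M x) ^ n)"
  proof (intro integral_le tail_power_integrable power_mono)
    fix x assume "x \<in> {d / 2..d}"
    then show "1 / 2 \<le> 1 - cdf M x" using cdf_nondecreasing[of x d] assms(4) by simp
  qed auto
  also have "\<dots> \<le> I n"
    unfolding I_def using cd assms by (intro integral_subset_le tail_power_integrable ballI tail_power_bounds) auto
  also have "d / 2 * (1 / 2) ^ n = 4 * c"
    by (simp add: c N power_divide)
  finally have I: "4 * c \<le> I n" .
  let ?t = "\<lambda>m. real (N choose m) * q ^ (N - m) * ((1 - q) ^ m * y_star r (cdf M) m c)"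
  \<comment> \<open>\<open>n\<close> and \<open>Suc n\<close> rejecters mean two acquired items and
    one; the other terms are nonnegative.\<close>
  have "sum ?t {n, Suc n} \<le> sum ?t {0..N - 1}"
    using q cd I_nonneg by (intro sum_mono2) (auto simp: N G)
  also have "\<dots> = Pi_star N r (cdf M) c + real N * q * p_star N r (cdf M) c"
    by (simp add: Pi_star_def q_def mult_ac)
  finally have "sum ?t {n, Suc n} \<le> Pi_star N r (cdf M) c + real N * q * (c + I (Suc n))"
    by (simp add: p_star_def I_def N)
  moreover have choose: "real (N choose n) = real N * real (Suc n) / 2"
    unfolding N by (induction n) (simp_all add: field_simps)
  moreover have choose': "N choose Suc n = N"
    by (simp add: N)
  \<comment> \<open>The \<open>I (Suc n)\<close> parts of resale revenue and payment cancel, leaving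
    the loss \<open>N * q * c * (1 - (1 - q) ^ Suc n)\<close>, which Bernoulli makes quadratic in
    \<open>q\<close>.\<close>
  moreover have "1 - real (Suc n) * q \<le> (1 - q) ^ Suc n"
    using Bernoulli_inequality[of "- q" "Suc n"] q by simp
  then have "real N * q * c * (1 - real (Suc n) * q) \<le> real N * q * c * (1 - q) ^ Suc n"
    using q cd by (intro mult_left_mono) auto
  moreover have "real N * real (Suc n) / 2 * q ^ 2 * (4 * c) \<le> real N * real (Suc n) / 2 * q ^ 2 * (c * (1 - q) ^ n + I n)"
    using q cd I by (intro mult_left_mono add_increasing) auto
  moreover have "0 < real N * real (Suc n) * q ^ 2 * c"
    using q cd by (simp add: N)
  moreover have "sum ?t {n, Suc n} = real N * real (Suc n) / 2 * q ^ 2 * (c * (1 - q) ^ n + I n)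
      + real N * q * (c * (1 - q) ^ Suc n + I (Suc n))"
  proof -
    have "N - n = 2" "N - Suc n = 1" by (simp_all add: N)
    then have "sum ?t {n, Suc n} = real (N choose n) * q ^ 2 * (c * (1 - q) ^ n + I n)
        + real N * q * (c * (1 - q) ^ Suc n + I (Suc n))"
      using choose' by (simp add: G del: power_Suc of_nat_Suc)
    then show ?thesis by (simp only: choose)
  qed
  ultimately show ?thesis
    by (simp only: algebra_simps power2_eq_square)
qed

end

section \<open>From a density to a cutoff small enough for positive profit\<close>

theorem proposition2:
  fixes N :: nat and r :: real and f :: "real \<Rightarrow> real" and M :: "real measure"
  assumes "2 \<le> N"
    and "0 < r" and "r \<le> 1"
    and "f \<in> borel_measurable borel" and "\<And>x. 0 \<le> f x"
    and "M = density lborel (\<lambda>x. ennreal (f x))" and "prob_space M"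
    and "cdf M 0 = 0" and "cdf M 1 = 1"
    and "\<And>v. 0 < v \<Longrightarrow> v \<le> 1 \<Longrightarrow> 0 < cdf M v"
  shows "(\<exists>p\<in>{0..r}. (\<exists>!c. cutoff_equilibrium N r M p c) \<and>
            (\<forall>c. cutoff_equilibrium N r M p c \<longrightarrow>
                 0 < speculator_expected_profit N r M p (cutoff_profile c)))
       \<and> (\<exists>v\<in>{0<..r}. 0 < Pi_star N r (cdf M) v)"
proof -
  have "emeasure M {x} = 0" for x
  proof -
    have "AE y in lborel. y \<notin> {x}" by (rule AE_not_in) auto
    then have "AE y in lborel. ennreal (f y) * indicator {x} y = 0" by eventually_elim simp
    then show ?thesis
      using assms(4) by (simp add: assms(6) emeasure_density nn_integral_0_iff_AE)
  qed
  then interpret atomless_distribution M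
    using assms(6,7) by (simp add: atomless_distribution_def atomless_distribution_axioms_def
        real_distribution_def real_distribution_axioms_def measure_def)
  \<comment> \<open>Continuity at 0, where the CDF vanishes, supplies a positive \<open>d\<close> at
    most \<open>r\<close> with \<open>cdf M d\<close> at most 1/2; halving \<open>s\<close> keeps
    \<open>d\<close> strictly inside the neighbourhood.\<close>
  have "isCont (cdf M) 0" by (simp add: isCont_cdf atomless)
  then have "\<forall>\<^sub>F x in at 0. cdf M x < 1 / 2"
    using assms(8) by (intro order_tendstoD(2)[OF isContD]) auto
  then obtain s where s: "0 < s" "\<And>x. x \<noteq> 0 \<Longrightarrow> \<bar>x\<bar> < s \<Longrightarrow> cdf M x < 1 / 2"
    by (auto simp: eventually_at dist_real_def)
  define d where "d = min r (s / 2)"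
  define c where "c = d / 2 ^ (N + 1)"
  have "0 < d" "d \<le> r" "d < s"
    using s(1) assms(2) by (auto simp: d_def)
  then have d: "0 < d" "d \<le> r" "cdf M d \<le> 1 / 2"
    using s(2)[of d] by simp_all
  have "(1::real) \<le> 2 ^ (N + 1)" by (rule one_le_power) simp
  then have "c \<le> d" "0 < c" using d by (auto simp: c_def divide_le_eq mult_le_cancel_left1 simp del: power_Suc power_add)
  then have c: "0 < c" "c \<le> r" "cdf M c < 1"
    using d cdf_nondecreasing[of c d] by auto
  have pos: "0 < Pi_star N r (cdf M) c"
    using assms c d by (intro Pi_star_pos[OF _ d c_def]) auto
  have unique: "c' = c" if "cutoff_equilibrium N r M (p_star N r (cdf M) c) c'" for c'
    using cutoff_equilibrium_unique[OF _ c(1,2) _ _ that] assms by simp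
  have "0 < speculator_expected_profit N r M (p_star N r (cdf M) c) (cutoff_profile c)"
    using pos c assms(1) by (simp add: speculator_expected_profit_eq)
  moreover have "cutoff_equilibrium N r M (p_star N r (cdf M) c) c" "p_star N r (cdf M) c \<in> {0..r}"
    using c by (intro cutoff_equilibrium_p_star p_star_in_Icc; simp)+
  moreover have "c \<in> {0<..r}" using c by simp
  ultimately show ?thesis using unique pos by blast
qed

end
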